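(* Let $(X,\mu)$ be a non-atomic measure space, $\mathcal H$ a separable Hilbert space, and $\{\phi_t\}_{t\in X}$ a continuous Bessel family in $\mathcal H$. Let $\mathcal S=\{S_{\phi,E}: E\subset X\text{ measurable}\}$ be the set of all partial frame operators. Then the closure of $\mathcal S$ in $\mathcal B(\mathcal H)$ with respect to the operator norm is convex.
   Context: A family $\{\phi_t\}_{t\in X}$ of vectors in $\mathcal H$ is a continuous Bessel family (with bound $B$) over the measure space $(X,\mu)$ if (i) for each $f\in\mathcal H$ the function $t\mapsto\langle f,\phi_t\rangle$ is measurable, and (ii) there is $B<\infty$ with $\int_X|\langle f,\phi_t\rangle|^2\,d\mu(t)\le B\|f\|^2$ for all $f\in\mathcal H$. For measurable $E\subset X$, the partial frame operator is $S_{\phi,E}f=\int_E\langle f,\phi_t\rangle\phi_t\,d\mu(t)$ (defined weakly), $f\in\mathcal H$. *)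

theory Defs
  imports "HOL-Analysis.Analysis"
begin

text \<open>A complex Hilbert space is modelled by a real Banach space type 'h together with a
  complex scalar multiplication cmult and a complex inner product cinner
  (linear in the first, conjugate-linear in the second argument) inducing the given norm.\<close>

definition complex_hilbert_structure ::
  "(complex \<Rightarrow> 'h::banach \<Rightarrow> 'h) \<Rightarrow> ('h \<Rightarrow> 'h \<Rightarrow> complex) \<Rightarrow> bool" where
  "complex_hilbert_structure cmult cinner \<longleftrightarrow>
     (\<forall>r x. cmult (complex_of_real r) x = r *\<^sub>R x) \<and>
     (\<forall>a b x. cmult (a * b) x = cmult a (cmult b x)) \<and>
     (\<forall>a b x. cmult (a + b) x = cmult a x + cmult b x) \<and>
     (\<forall>a x y. cmult a (x + y) = cmult a x + cmult a y) \<and>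
     (\<forall>x y. cinner x y = cnj (cinner y x)) \<and>
     (\<forall>x y z. cinner (x + y) z = cinner x z + cinner y z) \<and>
     (\<forall>a x y. cinner (cmult a x) y = a * cinner x y) \<and>
     (\<forall>x. cinner x x = complex_of_real ((norm x)\<^sup>2))"

definition separable_type :: "'h::metric_space itself \<Rightarrow> bool" where
  "separable_type _ \<longleftrightarrow> (\<exists>D::'h set. countable D \<and> closure D = UNIV)"

definition is_atom :: "'x measure \<Rightarrow> 'x set \<Rightarrow> bool" where
  "is_atom M A \<longleftrightarrow> A \<in> sets M \<and> emeasure M A > 0 \<and>
     (\<forall>B\<in>sets M. B \<subseteq> A \<longrightarrow> emeasure M B = 0 \<or> emeasure M (A - B) = 0)"

definition non_atomic :: "'x measure \<Rightarrow> bool" where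
  "non_atomic M \<longleftrightarrow> (\<nexists>A. is_atom M A)"

definition continuous_bessel ::
  "('h::real_normed_vector \<Rightarrow> 'h \<Rightarrow> complex) \<Rightarrow> 'x measure \<Rightarrow> ('x \<Rightarrow> 'h) \<Rightarrow> bool" where
  "continuous_bessel cinner M phi \<longleftrightarrow>
     (\<forall>f. (\<lambda>t. cinner f (phi t)) \<in> borel_measurable M) \<and>
     (\<exists>B::real. \<forall>f. (\<integral>\<^sup>+ t. ennreal ((cmod (cinner f (phi t)))\<^sup>2) \<partial>M)
                        \<le> ennreal (B * (norm f)\<^sup>2))"

definition is_partial_frame_op ::
  "('h::real_normed_vector \<Rightarrow> 'h \<Rightarrow> complex) \<Rightarrow> 'x measure \<Rightarrow> ('x \<Rightarrow> 'h) \<Rightarrow> 'x set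
     \<Rightarrow> ('h \<Rightarrow>\<^sub>L 'h) \<Rightarrow> bool" where
  "is_partial_frame_op cinner M phi E T \<longleftrightarrow>
     (\<forall>f g. cinner (blinfun_apply T f) g =
            (LINT t:E|M. cinner f (phi t) * cinner (phi t) g))"

definition partial_frame_ops ::
  "('h::real_normed_vector \<Rightarrow> 'h \<Rightarrow> complex) \<Rightarrow> 'x measure \<Rightarrow> ('x \<Rightarrow> 'h) \<Rightarrow> ('h \<Rightarrow>\<^sub>L 'h) set" where
  "partial_frame_ops cinner M phi = {T. \<exists>E\<in>sets M. is_partial_frame_op cinner M phi E T}"

end

theory Submission
  imports Defs
begin

text \<open>Approximate the family by one taking countably many values: there are disjoint cells of finite
  measure, covering the support, and vectors \<open>d\<^sub>m\<close> such that replacing \<open>phi t\<close> by \<open>d\<^sub>m\<close> on the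
  \<open>m\<close>-th cell changes every weighted partial frame operator (weights bounded by 1) by at most
  \<open>\<epsilon>\<close> in norm. For such a discretised family the partial frame operator of \<open>E\<close> depends only on the
  measures of the intersections of \<open>E\<close> with the cells. As the measure is non-atomic, for
  \<open>u + v = 1\<close> there is \<open>G\<close> whose intersection with each cell has exactly \<open>u\<close> times the measure of
  that of \<open>E\<close> plus \<open>v\<close> times that of \<open>F\<close>, so that \<open>G\<close> realises the convex combination for the
  discretised family.\<close>

section \<open>Non-atomic measures attain all intermediate values\<close>

text \<open>A set that is not an atom splits into two pieces of positive measure, and the smaller
  piece has at most half of the whole.\<close>

lemma non_atomic_halve:
  assumes na: "non_atomic M" and A: "A \<in> sets M" "emeasure M A < \<infinity>" "0 < measure M A"
  obtains B where "B \<in> sets M" "B \<subseteq> A" "0 < measure M B" "measure M B \<le> measure M A / 2"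
proof -
  have fin: "emeasure M B \<noteq> \<infinity>" if "B \<subseteq> A" for B
    using A emeasure_mono[OF that A(1)] by (auto simp: top_unique less_top)
  have "\<not> is_atom M A"
    using na by (auto simp: non_atomic_def)
  moreover have "emeasure M A > 0"
    using A(3) by (metis measure_eq_emeasure_eq_ennreal
        ennreal_0 less_irrefl not_gr_zero order_refl)
  ultimately obtain B where B: "B \<in> sets M" "B \<subseteq> A" "emeasure M B \<noteq> 0" "emeasure M (A - B) \<noteq> 0"
    using A(1) by (auto simp: is_atom_def)
  have pos: "0 < measure M B" "0 < measure M (A - B)"
    using B(3,4) fin[of B] fin[of "A - B"] B(2)
    by (auto simp: measure_def enn2real_positive_iff less_top zero_less_iff_neq_zero)
  have sum: "measure M (A - B) = measure M A - measure M B"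
    using A B fin[of A] by (intro measure_Diff) auto
  show ?thesis
  proof (cases "measure M B \<le> measure M A / 2")
    case True
    with that[of B] B pos show ?thesis by auto
  next
    case False
    with that[of "A - B"] A B pos sum show ?thesis by auto
  qed
qed

text \<open>Repeated halving keeps the measure positive and drives it to zero geometrically.\<close>

lemma non_atomic_small_subset:
  assumes na: "non_atomic M" and A: "A \<in> sets M" "emeasure M A < \<infinity>" "0 < measure M A"
    and e: "0 < (e::real)"
  obtains B where "B \<in> sets M" "B \<subseteq> A" "0 < measure M B" "measure M B < e"
proof -
  have iter: "\<exists>B\<in>sets M. B \<subseteq> A \<and> 0 < measure M B \<and> measure M B \<le> measure M A / 2 ^ n" for n
  proof (induction n)
    case 0
    then show ?case using A by auto
  next
    case (Suc n)
    then obtain B where B: "B \<in> sets M" "B \<subseteq> A" "0 < measure M B" "measure M B \<le> measure M A / 2 ^ n"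
      by auto
    have "emeasure M B < \<infinity>"
      using emeasure_mono[OF B(2) A(1)] A(2) by (rule le_less_trans)
    from non_atomic_halve[OF na B(1) this B(3)] obtain C where
      "C \<in> sets M" "C \<subseteq> B" "0 < measure M C" "measure M C \<le> measure M B / 2" .
    with B show ?case by (intro bexI[of _ C]) auto
  qed
  have "(\<lambda>n. measure M A / 2 ^ n) \<longlonglongrightarrow> 0"
    by (rule LIMSEQ_divide_realpow_zero) simp
  then obtain n where "measure M A / 2 ^ n < e"
    using order_tendstoD(2)[OF _ e] by (metis (lifting) eventually_sequentially order_refl)
  with iter[of n] that show ?thesis by fastforce
qed

text \<open>Greedy exhaustion: each step adds a set of at least half the largest measure still admissible,
  so a set of positive measure that remained admissible forever would make the measures diverge.\<close>

lemma non_atomic_intermediate_measure: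
  assumes na: "non_atomic M" and A: "A \<in> sets M" "emeasure M A < \<infinity>"
    and a: "0 \<le> a" "a \<le> measure M A"
  obtains B where "B \<in> sets M" "B \<subseteq> A" "measure M B = a"
proof -
  have fm: "B \<in> fmeasurable M" if "B \<in> sets M" "B \<subseteq> A" for B
    using that A by (auto intro!: fmeasurableI2[OF fmeasurableI, of A])
  define P where "P B \<longleftrightarrow> B \<in> sets M \<and> B \<subseteq> A \<and> measure M B \<le> a" for B
  \<comment> \<open>\<open>F B\<close> consists of the sets that may still be added to
    \<open>B\<close> without exceeding \<open>a\<close>. \<open>Q B B'\<close> says that passing to
    \<open>B'\<close> gains at least half of what any of them could contribute.\<close>
  define F where "F B = {C \<in> sets M. C \<subseteq> A - B \<and> measure M B + measure M C \<le> a}" for B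
  define Q where "Q B B' \<longleftrightarrow> B \<subseteq> B' \<and>
    (\<forall>C\<in>F B. measure M C \<le> 2 * (measure M B' - measure M B))" for B B'
  have step: "\<exists>B'. P B' \<and> Q B B'" if PB: "P B" for B
  proof -
    let ?S = "measure M ` F B"
    have bdd: "bdd_above ?S"
    proof (rule bdd_aboveI2)
      show "measure M C \<le> a" if "C \<in> F B" for C
        using that measure_nonneg[of M B] unfolding F_def mem_Collect_eq by linarith
    qed
    have ne: "{} \<in> F B" using PB by (auto simp: F_def P_def)
    \<comment> \<open>The supremum may not be attained, so only half of it is asked for; if it is
      zero, the empty set will do.\<close>
    have "\<exists>C\<in>F B. Sup ?S \<le> 2 * measure M C"
    proof (cases "Sup ?S \<le> 0")
      case True
      then show ?thesis using ne by force
    next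
      case False
      then have "Sup ?S / 2 < Sup ?S" by simp
      then obtain C where "C \<in> F B" "Sup ?S / 2 < measure M C"
        using less_cSupE[of "Sup ?S / 2" ?S] ne by blast
      then show ?thesis by (intro bexI[of _ C]) auto
    qed
    then obtain C where C: "C \<in> F B" "Sup ?S \<le> 2 * measure M C" by blast
    have sum: "measure M (B \<union> C) = measure M B + measure M C"
    proof (rule measure_Union)
      have "B \<in> fmeasurable M" "C \<in> fmeasurable M"
        using C(1) PB by (auto simp: F_def P_def intro!: fm)
      then show "emeasure M B \<noteq> \<infinity>" "emeasure M C \<noteq> \<infinity>" "B \<in> sets M" "C \<in> sets M"
        by (auto simp: fmeasurable_def)
    qed (use C(1) in \<open>auto simp: F_def\<close>)
    have "measure M D \<le> 2 * (measure M (B \<union> C) - measure M B)" if "D \<in> F B" for D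
      using cSup_upper[OF imageI[OF that] bdd] C(2) unfolding sum by argo
    then have "Q B (B \<union> C)" by (auto simp: Q_def)
    moreover have "P (B \<union> C)" using C(1) PB sum by (auto simp: P_def F_def)
    ultimately show ?thesis by blast
  qed
  have "\<exists>f. \<forall>n. P (f n) \<and> Q (f n) (f (Suc n))"
    using dependent_nat_choice[of "\<lambda>_. P" "\<lambda>_. Q"] step a(1)
    by (metis P_def empty_subsetI measure_empty sets.empty_sets)
  then obtain f where f: "\<And>n. P (f n)" "\<And>n. Q (f n) (f (Suc n))" by blast
  define B where "B = (\<Union>n. f n)"
  have B: "B \<in> sets M" "B \<subseteq> A" using f(1) by (auto simp: B_def P_def)
  have lim: "(\<lambda>n. measure M (f n)) \<longlonglongrightarrow> measure M B"
    unfolding B_def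
  proof (rule Lim_measure_incseq)
    show "incseq f" using f(2) by (intro incseq_SucI) (auto simp: Q_def)
    show "emeasure M (\<Union> (range f)) \<noteq> \<infinity>"
      using fm[OF B] unfolding B_def by (auto simp: fmeasurable_def)
  qed (use f(1) in \<open>auto simp: P_def\<close>)
  have le: "measure M B \<le> a"
    using f(1) by (intro LIMSEQ_le_const2[OF lim]) (auto simp: P_def)
  have "\<not> measure M B < a"
  proof
    assume lt: "measure M B < a"
    have "measure M (A - B) = measure M A - measure M B"
      using A B fm[OF A(1)] by (intro measure_Diff) auto
    then have pos: "0 < measure M (A - B)" using lt a by simp
    have "emeasure M (A - B) < \<infinity>" using fm[of "A - B"] A B by (auto simp: fmeasurable_def)
    from non_atomic_small_subset[OF na _ this pos, of "a - measure M B"] A B lt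
    obtain C where C: "C \<in> sets M" "C \<subseteq> A - B" "0 < measure M C" "measure M C < a - measure M B"
      by auto
    \<comment> \<open>\<open>C\<close> avoids the union \<open>B\<close> and fits into the remaining
      room, hence it is admissible at every stage. Its measure is then at most twice each increment,
      and the increments tend to zero.\<close>
    have "measure M C \<le> 2 * (measure M (f (Suc n)) - measure M (f n))" for n
    proof -
      have "measure M (f n) \<le> measure M B"
        using f(1) fm[OF B] by (intro measure_mono_fmeasurable) (auto simp: B_def P_def)
      then have "C \<in> F (f n)" using C by (auto simp: F_def B_def)
      then show ?thesis using f(2)[of n] by (auto simp: Q_def)
    qed
    moreover have "(\<lambda>n. 2 * (measure M (f (Suc n)) - measure M (f n))) \<longlonglongrightarrow>
        2 * (measure M B - measure M B)"
      by (intro tendsto_intros LIMSEQ_Suc lim)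
    ultimately have "measure M C \<le> 0"
      by (intro LIMSEQ_le_const[of _ "0::real"]) auto
    then show False using C by simp
  qed
  then show ?thesis using that B le by force
qed

section \<open>Complex Hilbert spaces: Cauchy-Schwarz, Riesz representation, operators from
  forms\<close>

locale complex_hilbert =
  fixes cmult :: "complex \<Rightarrow> 'h::banach \<Rightarrow> 'h"
    and cinner :: "'h \<Rightarrow> 'h \<Rightarrow> complex"
  assumes hilbert: "complex_hilbert_structure cmult cinner"
begin

lemma cinner_commute: "cinner y x = cnj (cinner x y)"
  and cinner_add_left: "cinner (x + y) z = cinner x z + cinner y z"
  and cinner_cmult_left: "cinner (cmult a x) y = a * cinner x y"
  and cinner_self: "cinner x x = complex_of_real ((norm x)\<^sup>2)"
  and cmult_of_real: "cmult (complex_of_real r) x = r *\<^sub>R x"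
  using hilbert unfolding complex_hilbert_structure_def by blast+

lemma cinner_add_right: "cinner x (y + z) = cinner x y + cinner x z"
  by (metis cinner_commute cinner_add_left complex_cnj_add)

lemma cinner_cmult_right: "cinner x (cmult a y) = cnj a * cinner x y"
  by (metis cinner_commute cinner_cmult_left complex_cnj_mult)

lemma cinner_scaleR_left: "cinner (r *\<^sub>R x) y = of_real r * cinner x y"
  by (metis cinner_cmult_left cmult_of_real)

lemma cinner_scaleR_right: "cinner x (r *\<^sub>R y) = of_real r * cinner x y"
  by (metis cinner_cmult_right cmult_of_real complex_cnj_complex_of_real)

lemma cinner_minus_left: "cinner (- x) y = - cinner x y"
  using cinner_scaleR_left[of "-1"] by simp

lemma cinner_minus_right: "cinner x (- y) = - cinner x y"
  using cinner_scaleR_right[of _ "-1"] by simp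

lemma cinner_diff_left: "cinner (x - y) z = cinner x z - cinner y z"
  using cinner_add_left[of x "- y"] by (simp add: cinner_minus_left)

lemma cinner_diff_right: "cinner x (y - z) = cinner x y - cinner x z"
  using cinner_add_right[of x y "- z"] by (simp add: cinner_minus_right)

lemma cinner_zero_left [simp]: "cinner 0 y = 0"
  using cinner_scaleR_left[of 0] by simp

lemma cinner_zero_right [simp]: "cinner x 0 = 0"
  using cinner_scaleR_right[of _ 0] by simp

lemma norm_add_sq: "(norm (x + y))\<^sup>2 = (norm x)\<^sup>2 + 2 * Re (cinner x y) + (norm y)\<^sup>2"
proof -
  have "complex_of_real ((norm (x + y))\<^sup>2) = cinner (x + y) (x + y)"
    by (simp only: cinner_self)
  also have "\<dots> = cinner x x + cinner x y + cnj (cinner x y) + cinner y y"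
    by (simp add: cinner_add_left cinner_add_right flip: cinner_commute)
  finally show ?thesis
    by (auto simp: cinner_self complex_eq_iff)
qed

lemma norm_diff_sq: "(norm (x - y))\<^sup>2 = (norm x)\<^sup>2 - 2 * Re (cinner x y) + (norm y)\<^sup>2"
  using norm_add_sq[of x "- y"] by (simp add: cinner_minus_right)

text \<open>The norm is given beforehand, so its triangle inequality can be squared and compared
  with \<open>norm_add_sq\<close>; this bounds the real part. Rotating \<open>x\<close> by the
  unimodular number \<open>a\<close> makes the inner product equal to its modulus.\<close>

lemma cinner_bound: "cmod (cinner x y) \<le> norm x * norm y"
proof -
  have re: "Re (cinner x y) \<le> norm x * norm y" for x y
    using power_mono[OF norm_triangle_ineq, of x y 2] norm_add_sq[of x y]
    by (simp add: power2_sum)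
  define z where "z = cinner x y"
  show ?thesis
  proof (cases "z = 0")
    case False
    define a where "a = cnj z / of_real (cmod z)"
    have "cmod a = 1" using False by (simp add: a_def norm_divide)
    have na: "norm (cmult a x) = norm x"
    proof -
      have "complex_of_real ((norm (cmult a x))\<^sup>2) = a * cnj a * cinner x x"
        by (simp only: cinner_cmult_left cinner_cmult_right mult_ac flip: cinner_self)
      also have "a * cnj a = 1" using \<open>cmod a = 1\<close> by (simp add: complex_norm_square[symmetric])
      finally have "(norm (cmult a x))\<^sup>2 = (norm x)\<^sup>2" 
        unfolding cinner_self by (metis mult_1 of_real_eq_iff)
      then show ?thesis by simp
    qed
    have "cinner (cmult a x) y = of_real (cmod z)"
      using False complex_norm_square[of z]
      by (simp add: cinner_cmult_left z_def[symmetric] a_def power2_eq_square divide_eq_eq mult.commute)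
    then show ?thesis using re[of "cmult a x" y] na by (simp add: z_def)
  qed (auto simp: z_def)
qed

text \<open>Variational argument: \<open>J\<close> is bounded below, the parallelogram law makes a
  minimising sequence Cauchy, and at the minimiser the first variation of \<open>J\<close>, which is
  twice the difference of the two sides, must vanish.\<close>

lemma Riesz_real:
  assumes L: "bounded_linear (L :: 'h \<Rightarrow> real)"
  shows "\<exists>y. \<forall>g. Re (cinner y g) = L g"
proof -
  interpret L: bounded_linear L by fact
  define J where "J g = (norm g)\<^sup>2 - 2 * L g" for g
  obtain K where K: "\<And>g. norm (L g) \<le> norm g * K" using L.bounded by blast
  have low: "- K\<^sup>2 \<le> J g" for g
    using K[of g] zero_le_power2[of "norm g - K"]
    by (simp add: J_def power2_diff abs_le_iff)
  define m where "m = Inf (range J)"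
  have bdd: "bdd_below (range J)" using low by (auto simp: bdd_below_def)
  have mJ: "m \<le> J g" for g unfolding m_def by (intro cInf_lower bdd) auto
  have "\<exists>y. J y < m + inverse (real (Suc n))" for n
    using cInf_lessD[of "range J" "m + inverse (real (Suc n))"] by (auto simp: m_def)
  then obtain y where y: "\<And>n. J (y n) < m + inverse (real (Suc n))" by metis
  \<comment> \<open>Parallelogram law, combined with the fact that \<open>J\<close> at the midpoint
    of \<open>a\<close> and \<open>b\<close> is at least \<open>m\<close>.\<close>
  have par: "(norm (a - b))\<^sup>2 \<le> 2 * ((J a - m) + (J b - m))" for a b
  proof -
    have "J ((1/2) *\<^sub>R (a + b)) = (norm (a + b))\<^sup>2 / 4 - L (a + b)"
      by (simp add: J_def L.scaleR power_divide del: scaleR_add_right)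
    then have "m \<le> (norm (a + b))\<^sup>2 / 4 - L (a + b)" using mJ by metis
    then show ?thesis
      unfolding norm_add_sq norm_diff_sq J_def L.add by (simp add: field_simps)
  qed
  have "Cauchy y"
  proof (rule metric_CauchyI)
    fix e :: real assume e: "e > 0"
    obtain N where N: "inverse (real (Suc N)) < e\<^sup>2 / 4"
      using reals_Archimedean[of "e\<^sup>2 / 4"] e by auto
    have J: "J (y n) - m < e\<^sup>2 / 4" if "n \<ge> N" for n
    proof -
      have "inverse (real (Suc n)) \<le> inverse (real (Suc N))" using that by simp
      then show ?thesis using y[of n] N by linarith
    qed
    have "dist (y i) (y j) < e" if "i \<ge> N" "j \<ge> N" for i j
    proof -
      have "(norm (y i - y j))\<^sup>2 < e\<^sup>2"
        using par[of "y i" "y j"] J[OF that(1)] J[OF that(2)] by argo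
      then show ?thesis using e by (simp add: dist_norm power2_less_imp_less)
    qed
    then show "\<exists>N. \<forall>i\<ge>N. \<forall>j\<ge>N. dist (y i) (y j) < e" by blast
  qed
  then obtain x where x: "y \<longlonglongrightarrow> x" using Cauchy_convergent convergent_def by blast
  have "(\<lambda>n. J (y n)) \<longlonglongrightarrow> J x"
    unfolding J_def by (intro tendsto_intros x L.tendsto)
  moreover have "(\<lambda>n. m + inverse (real (Suc n))) \<longlonglongrightarrow> m + 0"
    by (intro tendsto_intros LIMSEQ_inverse_real_of_nat)
  ultimately have Jx: "J x \<le> m"
    using y by (intro LIMSEQ_le[of "\<lambda>n. J (y n)" _ "\<lambda>n. m + inverse (real (Suc n))"])
      (auto intro: less_imp_le)
  have "Re (cinner x g) = L g" for g
  proof (rule ccontr)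
    assume ne: "Re (cinner x g) \<noteq> L g"
    define c where "c = Re (cinner x g) - L g"
    have g: "g \<noteq> 0" using ne by (auto simp: L.zero)
    have q: "0 \<le> 2 * t * c + t\<^sup>2 * (norm g)\<^sup>2" for t
    proof -
      have "J x \<le> J (x + t *\<^sub>R g)" using Jx mJ order_trans by blast
      then show ?thesis
        by (simp add: J_def norm_add_sq L.add L.scaleR cinner_scaleR_right c_def
            power_mult_distrib algebra_simps)
    qed
    \<comment> \<open>This is the value of the quadratic in \<open>q\<close> at its minimiser in
      \<open>t\<close>; it is negative unless \<open>c\<close> is zero.\<close>
    have "2 * (- c / (norm g)\<^sup>2) * c + (- c / (norm g)\<^sup>2)\<^sup>2 * (norm g)\<^sup>2 = - (c\<^sup>2 / (norm g)\<^sup>2)"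
      using g by (simp add: field_simps power2_eq_square)
    moreover have "c\<^sup>2 / (norm g)\<^sup>2 > 0" using ne g by (simp add: c_def)
    ultimately show False using q[of "- c / (norm g)\<^sup>2"] by linarith
  qed
  then show ?thesis by blast
qed

lemma cinner_ext:
  assumes "\<And>g. cinner x g = cinner y g" shows "x = y"
proof -
  have "cinner (x - y) (x - y) = 0" using assms by (simp add: cinner_diff_left)
  then show ?thesis by (simp add: cinner_self)
qed

lemma norm_le_if_cinner_le:
  assumes "\<And>g. cmod (cinner x g) \<le> c * norm g" "0 \<le> c" shows "norm x \<le> c"
proof (cases "x = 0")
  case False
  have "norm x * norm x \<le> c * norm x"
    using assms(1)[of x] by (simp add: cinner_self norm_mult power2_eq_square)
  then show ?thesis using False by simp
qed (use assms in simp)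

text \<open>For each \<open>f\<close> the Riesz representation of \<open>Q f\<close> gives the value
  of the operator at \<open>f\<close>; uniqueness of the representing vector makes this additive and
  homogeneous. Homogeneity in \<open>f\<close> is asked for real scalars because the operators in
  question are the real-linear ones of the blinfun type.\<close>

lemma bounded_form_operator:
  fixes Q :: "'h \<Rightarrow> 'h \<Rightarrow> complex"
  assumes addl: "\<And>f f' g. Q (f + f') g = Q f g + Q f' g"
    and scal: "\<And>r f g. Q (r *\<^sub>R f) g = of_real r * Q f g"
    and addr: "\<And>f g g'. Q f (g + g') = Q f g + Q f g'"
    and cmr: "\<And>a f g. Q f (cmult a g) = cnj a * Q f g"
    and bnd: "\<And>f g. cmod (Q f g) \<le> C * norm f * norm g" and C: "0 \<le> C"
  obtains T :: "'h \<Rightarrow>\<^sub>L 'h" where "\<And>f g. cinner (blinfun_apply T f) g = Q f g"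
proof -
  have "\<exists>y. \<forall>g. cinner y g = Q f g" for f
  proof -
    have scr: "Q f (r *\<^sub>R g) = of_real r * Q f g" for r g
      by (metis cmr cmult_of_real complex_cnj_complex_of_real)
    have "bounded_linear (\<lambda>g. Re (Q f g))"
      by (rule bounded_linear_intro[where K = "C * norm f"])
        (use bnd[of f] in \<open>auto simp: addr scr mult.commute intro: order_trans[OF abs_Re_le_cmod]\<close>)
    from Riesz_real[OF this] obtain y where y: "\<And>g. Re (cinner y g) = Re (Q f g)" by blast
    \<comment> \<open>The real part at i times \<open>g\<close> is the imaginary part at
      \<open>g\<close>, as both sides are conjugate-homogeneous in the second argument.\<close>
    have "Im (cinner y g) = Im (Q f g)" for g
      using y[of "cmult \<i> g"] by (simp add: cmr cinner_cmult_right)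
    with y show ?thesis by (auto simp: complex_eq_iff)
  qed
  then obtain t where t: "\<And>f g. cinner (t f) g = Q f g" by metis
  have "bounded_linear t"
  proof (rule bounded_linear_intro[where K = C])
    show "t (x + y) = t x + t y" for x y
      by (rule cinner_ext) (simp add: cinner_add_left t addl)
    show "t (r *\<^sub>R x) = r *\<^sub>R t x" for r x
      by (rule cinner_ext) (simp add: cinner_scaleR_left t scal)
    show "norm (t x) \<le> norm x * C" for x
      using bnd[of x] C by (intro norm_le_if_cinner_le) (auto simp: t mult_ac)
  qed
  then show ?thesis
    using that[of "Blinfun t"] by (simp add: bounded_linear_Blinfun_apply t)
qed

end

section \<open>Convexity of closures\<close>

text \<open>Convex combinations depend continuously on their points, so it suffices to approximate
  those of points of \<open>S\<close> itself by elements of \<open>S\<close>.\<close>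

lemma convex_closureI:
  fixes S :: "'a::real_normed_vector set"
  assumes "\<And>x y u v. \<lbrakk>x \<in> S; y \<in> S; 0 \<le> u; 0 \<le> v; u + v = 1\<rbrakk> \<Longrightarrow> u *\<^sub>R x + v *\<^sub>R y \<in> closure S"
  shows "convex (closure S)"
proof (rule convexI)
  fix x y and u v :: real
  assume xy: "x \<in> closure S" "y \<in> closure S" and uv: "0 \<le> u" "0 \<le> v" "u + v = 1"
  obtain a b where a: "\<And>n. a n \<in> S" "a \<longlonglongrightarrow> x" and b: "\<And>n. b n \<in> S" "b \<longlonglongrightarrow> y"
    using xy by (auto simp: closure_sequential)
  have "(\<lambda>n. u *\<^sub>R a n + v *\<^sub>R b n) \<longlonglongrightarrow> u *\<^sub>R x + v *\<^sub>R y"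
    by (intro tendsto_intros a b)
  then show "u *\<^sub>R x + v *\<^sub>R y \<in> closure S"
    by (rule closed_sequentially[OF closed_closure, rotated]) (use assms a b uv in auto)
qed

section \<open>Bessel families and existence of their partial frame operators\<close>

locale bessel_family = complex_hilbert cmult cinner
  for cmult :: "complex \<Rightarrow> 'h::banach \<Rightarrow> 'h" and cinner +
  fixes M :: "'x measure" and phi :: "'x \<Rightarrow> 'h"
  assumes bessel: "continuous_bessel cinner M phi"
begin

text \<open>The sesquilinear form of the rank-one operator that \<open>phi t\<close> contributes to
  the frame operator.\<close>

definition bessel_form :: "'h \<Rightarrow> 'h \<Rightarrow> 'x \<Rightarrow> complex" where
  "bessel_form f g t = cinner f (phi t) * cinner (phi t) g"

lemma measurable_cinner_left [measurable]: "(\<lambda>t. cinner f (phi t)) \<in> borel_measurable M"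
  using bessel by (auto simp: continuous_bessel_def)

lemma measurable_cinner_right [measurable]: "(\<lambda>t. cinner (phi t) f) \<in> borel_measurable M"
proof -
  have "(\<lambda>t. cnj (cinner f (phi t))) \<in> borel_measurable M"
    by (intro borel_measurable_continuous_on[where f = cnj]) (auto intro: continuous_intros)
  then show ?thesis by (subst (asm) cinner_commute[symmetric])
qed

text \<open>\<open>continuous_bessel\<close> leaves the sign of the bound open; its absolute value
  is a bound as well.\<close>

lemma bessel_bound:
  obtains B where "0 \<le> B"
    "\<And>f. (\<integral>\<^sup>+ t. ennreal ((cmod (cinner f (phi t)))\<^sup>2) \<partial>M) \<le> ennreal (B * (norm f)\<^sup>2)"
proof -
  obtain B where B: "\<And>f. (\<integral>\<^sup>+ t. ennreal ((cmod (cinner f (phi t)))\<^sup>2) \<partial>M) \<le> ennreal (B * (norm f)\<^sup>2)"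
    using bessel by (auto simp: continuous_bessel_def)
  have "ennreal (B * (norm f)\<^sup>2) \<le> ennreal (\<bar>B\<bar> * (norm f)\<^sup>2)" for f :: 'h
    by (intro ennreal_leI mult_right_mono) auto
  then show ?thesis using that[of "\<bar>B\<bar>"] B order_trans by (metis abs_ge_zero)
qed

lemma integrable_cinner_sq: "integrable M (\<lambda>t. (cmod (cinner f (phi t)))\<^sup>2)"
proof -
  obtain B where B: "(\<integral>\<^sup>+ t. ennreal ((cmod (cinner f (phi t)))\<^sup>2) \<partial>M) \<le> ennreal (B * (norm f)\<^sup>2)"
    using bessel_bound by metis
  show ?thesis
    by (rule integrableI_bounded) (use B in \<open>auto intro: le_less_trans\<close>)
qed

text \<open>Inequality of arithmetic and geometric means. It supplies an integrable majorant of the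
  form.\<close>

lemma cmod_bessel_form_le:
  "cmod (bessel_form f g t) \<le> ((cmod (cinner f (phi t)))\<^sup>2 + (cmod (cinner g (phi t)))\<^sup>2) / 2"
proof -
  have "cmod (cinner (phi t) g) = cmod (cinner g (phi t))"
    by (subst cinner_commute) (rule complex_mod_cnj)
  then show ?thesis
    using sum_squares_bound[of "cmod (cinner f (phi t))" "cmod (cinner g (phi t))"]
    by (simp add: bessel_form_def norm_mult)
qed

lemma measurable_bessel_form [measurable]: "bessel_form f g \<in> borel_measurable M"
  unfolding bessel_form_def[abs_def] by measurable

lemma integrable_bessel_form: "integrable M (bessel_form f g)"
proof (rule Bochner_Integration.integrable_bound)
  show "integrable M (\<lambda>t. ((cmod (cinner f (phi t)))\<^sup>2 + (cmod (cinner g (phi t)))\<^sup>2) / 2)"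
    by (intro integrable_divide Bochner_Integration.integrable_add integrable_cinner_sq)
  show "AE t in M. cmod (bessel_form f g t) \<le>
      norm (((cmod (cinner f (phi t)))\<^sup>2 + (cmod (cinner g (phi t)))\<^sup>2) / 2)"
    by (intro AE_I2 order_trans[OF cmod_bessel_form_le]) simp
qed measurable

lemma set_integrable_bessel_form: "E \<in> sets M \<Longrightarrow> set_integrable M E (bessel_form f g)"
  unfolding set_integrable_def by (intro integrable_mult_indicator integrable_bessel_form)

text \<open>Membership in \<open>partial_frame_ops\<close> presupposes that an operator exists for
  the set; it comes from the boundedness of the integrated form.\<close>

lemma partial_frame_op_exists:
  assumes E: "E \<in> sets M"
  obtains T where "is_partial_frame_op cinner M phi E T"
proof -
  define Q where "Q f g = (LINT t:E|M. bessel_form f g t)" for f g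
  obtain B where B: "0 \<le> B"
    "\<And>f. (\<integral>\<^sup>+ t. ennreal ((cmod (cinner f (phi t)))\<^sup>2) \<partial>M) \<le> ennreal (B * (norm f)\<^sup>2)"
    using bessel_bound by metis
  have int_le: "(LINT t|M. (cmod (cinner f (phi t)))\<^sup>2) \<le> B * (norm f)\<^sup>2" for f
    using B by (intro integral_real_bounded) auto
  have scl: "Q (r *\<^sub>R f) g = of_real r * Q f g" for r f g
    unfolding Q_def bessel_form_def by (simp add: cinner_scaleR_left mult.assoc)
  have cmr: "Q f (cmult a g) = cnj a * Q f g" for a f g
    unfolding Q_def bessel_form_def by (simp add: cinner_cmult_right mult_ac)
  have Q2: "cmod (Q f g) \<le> (B * (norm f)\<^sup>2 + B * (norm g)\<^sup>2) / 2" for f g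
  proof -
    have "cmod (Q f g) \<le> (LINT t|M. ((cmod (cinner f (phi t)))\<^sup>2 + (cmod (cinner g (phi t)))\<^sup>2) / 2)"
      unfolding Q_def set_lebesgue_integral_def
    proof (rule order_trans[OF integral_norm_bound integral_mono])
      show "integrable M (\<lambda>t. norm (indicat_real E t *\<^sub>R bessel_form f g t))"
        using set_integrable_bessel_form[OF E] by (intro integrable_norm) (simp add: set_integrable_def)
      show "norm (indicat_real E t *\<^sub>R bessel_form f g t)
          \<le> ((cmod (cinner f (phi t)))\<^sup>2 + (cmod (cinner g (phi t)))\<^sup>2) / 2" for t
        using cmod_bessel_form_le[of f g t] by (auto simp: indicator_def)
    qed (intro integrable_divide Bochner_Integration.integrable_add integrable_cinner_sq)
    also have "\<dots> = ((LINT t|M. (cmod (cinner f (phi t)))\<^sup>2) + (LINT t|M. (cmod (cinner g (phi t)))\<^sup>2)) / 2"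
      by (simp add: integrable_cinner_sq)
    also have "\<dots> \<le> (B * (norm f)\<^sup>2 + B * (norm g)\<^sup>2) / 2"
      using int_le[of f] int_le[of g] by argo
    finally show ?thesis .
  qed
  have scr: "Q f (r *\<^sub>R g) = of_real r * Q f g" for r f g
    using cmr[of f "of_real r" g] by (simp add: cmult_of_real)
  \<comment> \<open>\<open>Q2\<close> at the unit vectors \<open>sgn f\<close> and
    \<open>sgn g\<close> gives the bound \<open>B\<close>; homogeneity turns it into a bound by the
    product of the norms.\<close>
  have bnd: "cmod (Q f g) \<le> B * norm f * norm g" for f g
  proof (cases "f = 0 \<or> g = 0")
    case True
    then show ?thesis by (auto simp: Q_def bessel_form_def)
  next
    case False
    have "Q f g = of_real (norm f * norm g) * Q (sgn f) (sgn g)"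
      using False by (auto simp: sgn_div_norm scl scr field_simps)
    then have "cmod (Q f g) = norm f * norm g * cmod (Q (sgn f) (sgn g))"
      by (simp add: norm_mult)
    moreover have "cmod (Q (sgn f) (sgn g)) \<le> B"
      using Q2[of "sgn f" "sgn g"] False by (simp add: norm_sgn)
    ultimately show ?thesis
      using mult_left_mono[of "cmod (Q (sgn f) (sgn g))" B "norm f * norm g"] by (simp add: mult_ac)
  qed
  have addl: "Q (f + f') g = Q f g + Q f' g" for f f' g
    unfolding Q_def set_integral_add(2)[OF set_integrable_bessel_form set_integrable_bessel_form, OF E E, symmetric]
    by (simp add: bessel_form_def[abs_def] cinner_add_left distrib_right)
  have addr: "Q f (g + g') = Q f g + Q f g'" for f g g'
    unfolding Q_def set_integral_add(2)[OF set_integrable_bessel_form set_integrable_bessel_form, OF E E, symmetric]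
    by (simp add: bessel_form_def[abs_def] cinner_add_right distrib_left)
  from bounded_form_operator[OF addl scl addr cmr bnd B(1)]
  obtain T where "\<And>f g. cinner (blinfun_apply T f) g = Q f g" by blast
  then show ?thesis using that[of T] by (simp add: is_partial_frame_op_def Q_def bessel_form_def)
qed

section \<open>Discretisation of the family\<close>

text \<open>The family is only weakly measurable. By \<open>key\<close> and density, the squared
  norm is a countable supremum of functions built from inner products with fixed vectors.\<close>

lemma measurable_norm_phi:
  assumes d: "closure (range (d :: nat \<Rightarrow> 'h)) = UNIV"
  shows "(\<lambda>t. norm (phi t)) \<in> borel_measurable M"
proof -
  have key: "2 * Re (cinner (d n) x) - (norm (d n))\<^sup>2 = (norm x)\<^sup>2 - (norm (d n - x))\<^sup>2" for n x
    by (simp add: norm_diff_sq)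
  have bdd: "bdd_above (range (\<lambda>n. 2 * Re (cinner (d n) x) - (norm (d n))\<^sup>2))" for x
    unfolding key by (rule bdd_aboveI2[where M = "(norm x)\<^sup>2"]) simp
  have "(SUP n. 2 * Re (cinner (d n) x) - (norm (d n))\<^sup>2) = (norm x)\<^sup>2" for x
  proof (rule cSup_eq)
    fix y assume y: "\<And>z. z \<in> range (\<lambda>n. 2 * Re (cinner (d n) x) - (norm (d n))\<^sup>2) \<Longrightarrow> z \<le> y"
    show "(norm x)\<^sup>2 \<le> y"
    proof (rule field_le_epsilon)
      fix e :: real assume e: "0 < e"
      have "x \<in> closure (range d)" using d by simp
      then obtain n where "dist (d n) x < sqrt e"
        using e by (force simp: closure_approachable)
      then have "(norm (d n - x))\<^sup>2 < e"
        using e real_less_lsqrt by (metis dist_norm norm_ge_zero power_strict_mono real_sqrt_pow2 less_imp_le pos2)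
      then show "(norm x)\<^sup>2 \<le> y + e"
        using y[of "2 * Re (cinner (d n) x) - (norm (d n))\<^sup>2"] unfolding key by auto
    qed
  qed (auto simp: key)
  then have eq: "norm (phi t) = sqrt (SUP n. 2 * Re (cinner (d n) (phi t)) - (norm (d n))\<^sup>2)" for t
    by simp
  have "(\<lambda>t. SUP n. 2 * Re (cinner (d n) (phi t)) - (norm (d n))\<^sup>2) \<in> borel_measurable M"
    using bdd by (intro borel_measurable_cSUP) auto
  then show ?thesis unfolding eq by measurable
qed

text \<open>Replace \<open>x\<close> by \<open>y\<close> in one factor at a time. The last factor of
  the bound becomes \<open>err\<close>, the cost of replacing \<open>phi t\<close> by a vector of
  the dense sequence.\<close>

lemma norm_rank_one_diff:
  "cmod (cinner f x * cinner x g - cinner f y * cinner y g)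
    \<le> norm f * norm g * (norm (x - y) * (norm x + norm y))"
proof -
  have "cinner f x * cinner x g - cinner f y * cinner y g =
      cinner f (x - y) * cinner x g + cinner f y * cinner (x - y) g"
    by (simp add: cinner_diff_left cinner_diff_right algebra_simps)
  also have "cmod \<dots> \<le> cmod (cinner f (x - y)) * cmod (cinner x g) + cmod (cinner f y) * cmod (cinner (x - y) g)"
    by (metis norm_mult norm_triangle_ineq)
  also have "\<dots> \<le> (norm f * norm (x - y)) * (norm x * norm g) + (norm f * norm y) * (norm (x - y) * norm g)"
    by (intro add_mono mult_mono cinner_bound) auto
  finally show ?thesis by (simp add: algebra_simps)
qed

text \<open>The weight makes the measure \<sigma>-finite on the support of the family and dominates the
  pointwise error of the discretisation.\<close>

lemma integrable_weight:
  assumes d: "closure (range (d :: nat \<Rightarrow> 'h)) = UNIV"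
  obtains \<rho> :: "'x \<Rightarrow> ennreal" and K where
    "\<rho> \<in> borel_measurable M" "0 < K" "(\<integral>\<^sup>+ t. \<rho> t \<partial>M) \<le> ennreal K" "\<And>t. phi t \<noteq> 0 \<Longrightarrow> 0 < \<rho> t"
proof -
  obtain B where B: "0 \<le> B"
    "\<And>f. (\<integral>\<^sup>+ t. ennreal ((cmod (cinner f (phi t)))\<^sup>2) \<partial>M) \<le> ennreal (B * (norm f)\<^sup>2)"
    using bessel_bound by metis
  \<comment> \<open>The denominator absorbs the squared norm of \<open>d n\<close> in the Bessel
    bound, and the power of 1/2 makes the sum over \<open>n\<close> converge.\<close>
  define c where "c n = (1/2) ^ n / (1 + (norm (d n))\<^sup>2)" for n
  have c: "0 < c n" for n unfolding c_def by (intro divide_pos_pos add_pos_nonneg) auto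
  define \<rho> where "\<rho> t = (\<Sum>n. ennreal (c n) * ennreal ((cmod (cinner (d n) (phi t)))\<^sup>2))" for t
  have "(\<integral>\<^sup>+ t. \<rho> t \<partial>M) = (\<Sum>n. ennreal (c n) * (\<integral>\<^sup>+ t. ennreal ((cmod (cinner (d n) (phi t)))\<^sup>2) \<partial>M))"
    unfolding \<rho>_def by (subst nn_integral_suminf) (auto simp: nn_integral_cmult)
  also have "\<dots> \<le> (\<Sum>n. ennreal ((1/2) ^ n * B))"
  proof (intro suminf_le allI)
    fix n
    have "ennreal (c n) * (\<integral>\<^sup>+ t. ennreal ((cmod (cinner (d n) (phi t)))\<^sup>2) \<partial>M)
        \<le> ennreal (c n) * ennreal (B * (norm (d n))\<^sup>2)"
      by (intro mult_left_mono B) auto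
    also have "\<dots> = ennreal (c n * (B * (norm (d n))\<^sup>2))"
      using c[of n] by (intro ennreal_mult'[symmetric]) auto
    also have "c n * (B * (norm (d n))\<^sup>2) = (1/2) ^ n * B * ((norm (d n))\<^sup>2 / (1 + (norm (d n))\<^sup>2))"
      by (simp add: c_def)
    also have "\<dots> \<le> (1/2) ^ n * B * 1"
      using B(1) by (intro mult_left_mono) (auto simp: divide_le_eq add_pos_nonneg)
    finally show "ennreal (c n) * (\<integral>\<^sup>+ t. ennreal ((cmod (cinner (d n) (phi t)))\<^sup>2) \<partial>M)
        \<le> ennreal ((1/2) ^ n * B)" by (simp add: ennreal_leI)
  qed auto
  also have "\<dots> = ennreal (2 * B)"
    using B(1) geometric_sums[of "1/2 :: real"] by (intro suminf_ennreal_eq sums_mult2) auto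
  \<comment> \<open>Adding 1 keeps the bound positive even when \<open>B\<close> is zero, so that it
    can serve as a divisor.\<close>
  also have "\<dots> \<le> ennreal (2 * B + 1)" by (intro ennreal_leI) simp
  finally have int: "(\<integral>\<^sup>+ t. \<rho> t \<partial>M) \<le> ennreal (2 * B + 1)" .
  \<comment> \<open>A vector whose distance to \<open>phi t\<close> is less than the norm of
    \<open>phi t\<close> cannot be orthogonal to it, by Pythagoras.\<close>
  have pos: "0 < \<rho> t" if nz: "phi t \<noteq> 0" for t
  proof -
    have "phi t \<in> closure (range d)" using d by simp
    then obtain n where n: "dist (d n) (phi t) < norm (phi t)"
      using nz by (force simp: closure_approachable)
    have "cinner (d n) (phi t) \<noteq> 0"
    proof
      assume "cinner (d n) (phi t) = 0"
      then have "(norm (d n - phi t))\<^sup>2 = (norm (d n))\<^sup>2 + (norm (phi t))\<^sup>2"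
        by (simp add: norm_diff_sq)
      moreover have "(norm (d n - phi t))\<^sup>2 < (norm (phi t))\<^sup>2"
        using n by (intro power_strict_mono) (auto simp: dist_norm)
      ultimately show False by simp
    qed
    then have "0 < ennreal (c n) * ennreal ((cmod (cinner (d n) (phi t)))\<^sup>2)"
      using c[of n] by (simp add: ennreal_zero_less_mult_iff)
    also have "\<dots> \<le> (\<Sum>k<Suc n. ennreal (c k) * ennreal ((cmod (cinner (d k) (phi t)))\<^sup>2))"
      by simp
    also have "\<dots> \<le> \<rho> t" unfolding \<rho>_def by (intro sum_le_suminf) auto
    finally show ?thesis .
  qed
  show ?thesis
    by (rule that[OF _ _ int pos]) (use B(1) in \<open>auto simp: \<rho>_def\<close>)
qed

text \<open>The estimate is made on forms, uniformly in \<open>f\<close> and \<open>g\<close>; in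
  this product shape it is a bound by \<open>e\<close> on the operator norm.\<close>

lemma approximate_convexity:
  assumes na: "non_atomic M" and d: "closure (range (d :: nat \<Rightarrow> 'h)) = UNIV"
    and E [measurable]: "E \<in> sets M" and F [measurable]: "F \<in> sets M"
    and uv: "0 \<le> u" "0 \<le> v" "u + v = 1" and e: "0 < (e::real)"
  obtains G where "G \<in> sets M"
    "\<And>f g. cmod ((LINT t:G|M. bessel_form f g t)
        - (u *\<^sub>R (LINT t:E|M. bessel_form f g t) + v *\<^sub>R (LINT t:F|M. bessel_form f g t)))
      \<le> e * norm f * norm g"
proof -
  obtain \<rho> K where \<rho> [measurable]: "\<rho> \<in> borel_measurable M" and K: "0 < K"
    and int: "(\<integral>\<^sup>+ t. \<rho> t \<partial>M) \<le> ennreal K" and pos: "\<And>t. phi t \<noteq> 0 \<Longrightarrow> 0 < \<rho> t"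
    using integrable_weight[OF d] by metis
  note [measurable] = measurable_norm_phi[OF d]
  define \<epsilon> where "\<epsilon> = ennreal (e / K)"
  have \<epsilon>: "0 < \<epsilon>" using e K by (simp add: \<epsilon>_def)
  \<comment> \<open>Only the norm of \<open>phi\<close> and its inner products with fixed vectors
    are known to be measurable, so the distance is written in terms of these.\<close>
  have dist_eq: "norm (phi t - d n) =
      sqrt ((norm (phi t))\<^sup>2 - 2 * Re (cinner (phi t) (d n)) + (norm (d n))\<^sup>2)" for t n
    by (simp flip: norm_diff_sq)
  define err where "err n t = norm (phi t - d n) * (norm (phi t) + norm (d n))" for n t
  have err_meas [measurable]: "err n \<in> borel_measurable M" for n
    unfolding err_def dist_eq by measurable
  \<comment> \<open>The index \<open>m\<close> codes a pair. Its first component selects a vector of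
    \<open>d\<close> with error below \<open>\<epsilon> * \<rho> t\<close>; its second is a
    \<open>k\<close> with \<open>\<rho> t\<close> at least 1/k, which will give the cells finite
    measure by Markov's inequality.\<close>
  define A where "A m t \<longleftrightarrow> ennreal (err (fst (prod_decode m)) t) < \<epsilon> * \<rho> t \<and>
    1 \<le> of_nat (snd (prod_decode m)) * \<rho> t" for m t
  have A_meas [measurable]: "Measurable.pred M (A m)" for m
    unfolding A_def[abs_def] by measurable
  \<comment> \<open>The least index is a measurable choice and yields disjoint cells. Where
    \<open>phi t\<close> is zero an index need not exist; such points are excluded by
    \<open>N0\<close>.\<close>
  define idx where "idx t = (LEAST m. A m t)" for t
  have idx [measurable]: "idx \<in> measurable M (count_space UNIV)"
    unfolding idx_def[abs_def] by measurable
  have A_idx: "A (idx t) t" if nz: "phi t \<noteq> 0" for t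
  proof -
    note p = pos[OF nz]
    obtain k :: nat where k: "1 \<le> of_nat k * \<rho> t"
    proof (cases "\<rho> t = top")
      case True
      then show ?thesis using that[of 1] by simp
    next
      case False
      then obtain r where r: "\<rho> t = ennreal r" "0 < r"
        using p by (cases "\<rho> t") auto
      obtain k :: nat where "1 / r < real k" using reals_Archimedean2 by blast
      then have "1 \<le> real k * r" using r by (simp add: field_simps)
      then have "ennreal 1 \<le> ennreal (real k * r)" by (rule ennreal_leI)
      then show ?thesis
        using that[of k] r by (simp add: ennreal_mult ennreal_of_nat_eq_real_of_nat)
    qed
    \<comment> \<open>\<open>\<epsilon> * \<rho> t\<close> may be infinite, so a positive real below
      it is used as the error to be reached by density.\<close>
    obtain s where s: "0 < s" "ennreal s \<le> \<epsilon> * \<rho> t"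
    proof (cases "\<epsilon> * \<rho> t = top")
      case True
      then show ?thesis using that[of 1] by simp
    next
      case False
      then obtain r where "\<epsilon> * \<rho> t = ennreal r" "0 \<le> r" by (cases "\<epsilon> * \<rho> t") auto
      moreover have "0 < \<epsilon> * \<rho> t" using \<epsilon> p by (simp add: ennreal_zero_less_mult_iff)
      ultimately show ?thesis using that[of r] by simp
    qed
    have "((\<lambda>y. norm (phi t - y) * (norm (phi t) + norm y)) \<longlongrightarrow> norm (phi t - phi t) * (norm (phi t) + norm (phi t))) (nhds (phi t))"
      by (intro tendsto_intros filterlim_ident)
    then have "\<forall>\<^sub>F y in nhds (phi t). norm (phi t - y) * (norm (phi t) + norm y) < s"
      using s(1) by (intro order_tendstoD(2)) auto
    then obtain S where S: "open S" "phi t \<in> S"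
      "\<And>y. y \<in> S \<Longrightarrow> norm (phi t - y) * (norm (phi t) + norm y) < s"
      by (auto simp: eventually_nhds)
    have "S \<inter> range d \<noteq> {}"
      using S d open_Int_closure_eq_empty[of S "range d"] by auto
    then obtain n where n: "err n t < s" using S(3) by (auto simp: err_def)
    have "ennreal (err n t) < ennreal s"
      using n by (intro ennreal_lessI s(1))
    with s(2) have "ennreal (err n t) < \<epsilon> * \<rho> t" by (rule less_le_trans[rotated])
    with k have "A (prod_encode (n, k)) t" by (simp add: A_def)
    then show ?thesis unfolding idx_def by (rule LeastI)
  qed
  define N0 where "N0 = {t \<in> space M. phi t \<noteq> 0}"
  have "{t \<in> space M. norm (phi t) \<noteq> 0} \<in> sets M" by measurable
  then have N0 [measurable]: "N0 \<in> sets M" by (simp add: N0_def)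
  define X where "X m = {t \<in> N0. idx t = m}" for m
  have X_eq: "X m = N0 \<inter> (idx -` {m} \<inter> space M)" for m
    using sets.sets_into_space[OF N0] by (auto simp: X_def)
  have X [measurable]: "X m \<in> sets M" for m
    unfolding X_eq by (intro sets.Int N0 measurable_sets[OF idx]) auto
  have X_disj: "X i \<inter> X j = {}" if "i \<noteq> j" for i j using that by (auto simp: X_def)
  have X_UN: "(\<Union>m. X m) = N0" by (auto simp: X_def)
  have X_fin: "emeasure M (X m) < \<infinity>" for m
  proof -
    define c :: ennreal where "c = of_nat (snd (prod_decode m))"
    have "X m \<subseteq> {t \<in> space M. 1 \<le> c * \<rho> t}"
      using A_idx sets.sets_into_space[OF N0] by (auto simp: X_def N0_def A_def c_def)
    then have "emeasure M (X m) \<le> emeasure M {t \<in> space M. 1 \<le> c * \<rho> t}"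
      by (intro emeasure_mono) auto
    also have "\<dots> \<le> c * (\<integral>\<^sup>+ t. \<rho> t * indicator (space M) t \<partial>M)"
      by (intro nn_integral_Markov_inequality) auto
    also have "(\<integral>\<^sup>+ t. \<rho> t * indicator (space M) t \<partial>M) = (\<integral>\<^sup>+ t. \<rho> t \<partial>M)"
      by (intro nn_integral_cong) auto
    also have "c * \<dots> < \<infinity>"
      using le_less_trans[OF int ennreal_less_top] by (simp add: c_def ennreal_mult_less_top of_nat_less_top)
    finally show ?thesis .
  qed
  have fmX: "S \<in> fmeasurable M" if "S \<in> sets M" "S \<subseteq> X m" for S m
    using that X_fin[of m] X[of m] by (intro fmeasurableI2[OF fmeasurableI, of "X m"]) auto
  have "\<exists>G. G \<in> sets M \<and> G \<subseteq> X m \<and>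
      measure M G = u * measure M (E \<inter> X m) + v * measure M (F \<inter> X m)" for m
  proof -
    have "measure M (S \<inter> X m) \<le> measure M (X m)" if "S \<in> sets M" for S
      using that X[of m] fmX[OF X order_refl] by (intro measure_mono_fmeasurable) auto
    then have "u * measure M (E \<inter> X m) + v * measure M (F \<inter> X m) \<le> measure M (X m)"
      using uv E F by (intro convex_bound_le) auto
    with non_atomic_intermediate_measure[OF na X X_fin, of "u * measure M (E \<inter> X m) + v * measure M (F \<inter> X m)" m]
      uv show ?thesis by auto
  qed
  then obtain G' where G': "\<And>m. G' m \<in> sets M" "\<And>m. G' m \<subseteq> X m"
    "\<And>m. measure M (G' m) = u * measure M (E \<inter> X m) + v * measure M (F \<inter> X m)" by metis
  define G where "G = (\<Union>m. G' m)"
  have G [measurable]: "G \<in> sets M" using G'(1) by (auto simp: G_def)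
  have G_X: "G \<inter> X m = G' m" for m
  proof (intro equalityI subsetI)
    fix t assume "t \<in> G \<inter> X m"
    then obtain k where k: "t \<in> G' k" "t \<in> X m" by (auto simp: G_def)
    moreover have "t \<in> X k" using G'(2) k(1) by (rule subsetD)
    ultimately show "t \<in> G' m" by (simp add: X_def)
  next
    fix t assume "t \<in> G' m"
    moreover from this have "t \<in> X m" by (rule subsetD[OF G'(2)])
    ultimately show "t \<in> G \<inter> X m" by (auto simp: G_def)
  qed
  \<comment> \<open>The weight of the form for \<open>G\<close> minus the convex combination of
    those for \<open>E\<close> and \<open>F\<close>. It is bounded by 1 and, by the choice of
    \<open>G\<close>, integrates to zero over each cell.\<close>
  define w where "w t = indicat_real G t - (u * indicat_real E t + v * indicat_real F t)" for t
  have w_meas [measurable]: "w \<in> borel_measurable M"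
    unfolding w_def[abs_def] by measurable
  have w_le: "\<bar>w t\<bar> \<le> 1" for t
    using uv by (auto simp: w_def indicator_def)
  have int_ind: "integrable M (indicat_real (S \<inter> X m))" "(LINT t|M. indicat_real (S \<inter> X m) t) = measure M (S \<inter> X m)"
    if "S \<in> sets M" for S m
  proof -
    have "S \<inter> X m \<in> fmeasurable M" using that X by (intro fmX) auto
    then show "integrable M (indicat_real (S \<inter> X m))"
      by (intro integrable_real_indicator) (auto simp: fmeasurable_def)
    show "(LINT t|M. indicat_real (S \<inter> X m) t) = measure M (S \<inter> X m)"
      using that sets.sets_into_space[OF X] by (auto intro!: arg_cong[where f = "measure M"])
  qed
  have w_int: "integrable M (\<lambda>t. indicat_real (X m) t * w t)"
    "(LINT t|M. indicat_real (X m) t * w t) = 0" for m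
  proof -
    have eq: "indicat_real (X m) t * w t = indicat_real (G \<inter> X m) t
        - (u * indicat_real (E \<inter> X m) t + v * indicat_real (F \<inter> X m) t)" for t
      by (simp add: w_def indicator_inter_arith algebra_simps)
    show "integrable M (\<lambda>t. indicat_real (X m) t * w t)"
      unfolding eq using int_ind(1)[OF G] int_ind(1)[OF E] int_ind(1)[OF F]
      by (intro Bochner_Integration.integrable_diff Bochner_Integration.integrable_add
          integrable_mult_right)
    from eq have "(LINT t|M. indicat_real (X m) t * w t) =
        measure M (G \<inter> X m) - (u * measure M (E \<inter> X m) + v * measure M (F \<inter> X m))"
      using int_ind[OF G] int_ind[OF E] int_ind[OF F] by (simp del: Bochner_Integration.integral_indicator)
    then show "(LINT t|M. indicat_real (X m) t * w t) = 0" by (simp add: G_X G'(3))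
  qed
  define h where "h t = d (fst (prod_decode (idx t)))" for t
  \<comment> \<open>The error of the discretisation. Outside \<open>N0\<close> both
    \<open>phi\<close> and the form vanish, so subtracting \<open>D\<close> from
    \<open>bessel_form\<close> leaves the discretised form, extended by zero.\<close>
  define D where "D f g t = indicat_real N0 t *\<^sub>R
    (cinner f (phi t) * cinner (phi t) g - cinner f (h t) * cinner (h t) g)" for f g t
  have D_meas [measurable]: "D f g \<in> borel_measurable M" for f g
  proof -
    have "(\<lambda>t. (\<lambda>m. cinner f (d (fst (prod_decode m))) * cinner (d (fst (prod_decode m))) g) (idx t))
        \<in> borel_measurable M"
      by (rule measurable_compose[OF idx]) simp
    then show ?thesis unfolding D_def[abs_def] h_def by measurable
  qed
  have D_le: "ennreal (cmod (D f g t)) \<le> ennreal (norm f * norm g) * (\<epsilon> * \<rho> t)" if "t \<in> space M" for f g t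
  proof (cases "t \<in> N0")
    case True
    then have nz: "phi t \<noteq> 0" by (simp add: N0_def)
    have "ennreal (cmod (D f g t)) \<le> ennreal (norm f * norm g * err (fst (prod_decode (idx t))) t)"
      using True norm_rank_one_diff[of f "phi t" g "h t"]
      by (intro ennreal_leI) (simp add: D_def err_def h_def)
    also have "\<dots> = ennreal (norm f * norm g) * ennreal (err (fst (prod_decode (idx t))) t)"
      by (intro ennreal_mult) (auto simp: err_def)
    also have "\<dots> \<le> ennreal (norm f * norm g) * (\<epsilon> * \<rho> t)"
      using A_idx[OF nz] by (intro mult_left_mono) (auto simp: A_def)
    finally show ?thesis .
  qed (simp add: D_def)
  have D_nn: "(\<integral>\<^sup>+ t. ennreal (cmod (D f g t)) \<partial>M) \<le> ennreal (e * norm f * norm g)" for f g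
  proof -
    have "(\<integral>\<^sup>+ t. ennreal (cmod (D f g t)) \<partial>M) \<le> (\<integral>\<^sup>+ t. ennreal (norm f * norm g) * (\<epsilon> * \<rho> t) \<partial>M)"
      by (intro nn_integral_mono D_le)
    also have "\<dots> = ennreal (norm f * norm g) * (\<epsilon> * (\<integral>\<^sup>+ t. \<rho> t \<partial>M))"
      by (simp add: nn_integral_cmult)
    also have "\<dots> \<le> ennreal (norm f * norm g) * (\<epsilon> * ennreal K)"
      by (intro mult_left_mono int) auto
    also have "\<epsilon> * ennreal K = ennreal e"
      using e K by (simp add: \<epsilon>_def flip: ennreal_mult)
    also have "ennreal (norm f * norm g) * ennreal e = ennreal (e * norm f * norm g)"
      using e by (simp add: mult_ac flip: ennreal_mult)
    finally show ?thesis .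
  qed
  have D_int: "integrable M (D f g)" for f g
    by (rule integrableI_bounded) (use le_less_trans[OF D_nn ennreal_less_top] in auto)
  have w_mult: "integrable M (\<lambda>t. w t *\<^sub>R P t)" if "integrable M P" for P :: "'x \<Rightarrow> complex"
  proof (rule Bochner_Integration.integrable_bound[OF that])
    show "AE t in M. norm (w t *\<^sub>R P t) \<le> norm (P t)"
      using w_le by (auto intro!: AE_I2 mult_left_le_one_le)
  qed (use that in \<open>auto intro!: borel_measurable_scaleR\<close>)
  have D_eq: "bessel_form f g t - D f g t = indicat_real N0 t *\<^sub>R (cinner f (h t) * cinner (h t) g)"
    if "t \<in> space M" for f g t
    using that by (auto simp: D_def bessel_form_def N0_def indicator_def)
  \<comment> \<open>On each cell the integrand is \<open>w\<close> times a constant, hence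
    integrates to zero; countable additivity over the cells does the rest.\<close>
  have discrete: "(LINT t|M. w t *\<^sub>R (bessel_form f g t - D f g t)) = 0" for f g
  proof -
    define P where "P t = w t *\<^sub>R (bessel_form f g t - D f g t)" for t
    have P: "integrable M P"
      unfolding P_def by (intro w_mult Bochner_Integration.integrable_diff integrable_bessel_form D_int)
    have cell: "(LINT t:X m|M. P t) = 0" for m
    proof -
      define c where "c = cinner f (d (fst (prod_decode m))) * cinner (d (fst (prod_decode m))) g"
      have "(LINT t:X m|M. P t) = (LINT t|M. (indicat_real (X m) t * w t) *\<^sub>R c)"
        unfolding set_lebesgue_integral_def
        by (intro Bochner_Integration.integral_cong)
          (auto simp: P_def D_eq indicator_def X_def c_def h_def)
      also have "\<dots> = (LINT t|M. indicat_real (X m) t * w t) *\<^sub>R c"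
        by (rule integral_scaleR_left) (rule w_int)
      finally show ?thesis by (simp add: w_int(2))
    qed
    have "(LINT t|M. P t) = (LINT t:(\<Union>m. X m)|M. P t)"
      unfolding set_lebesgue_integral_def X_UN
      by (intro Bochner_Integration.integral_cong) (auto simp: P_def D_eq indicator_def)
    also have "\<dots> = (\<Sum>m. (LINT t:X m|M. P t))"
    proof (rule lebesgue_integral_countable_add[OF X X_disj])
      show "set_integrable M (\<Union>m. X m) P"
        unfolding X_UN set_integrable_def by (intro integrable_mult_indicator N0 P)
    qed
    also have "\<dots> = 0" by (simp add: cell)
    finally show ?thesis by (simp add: P_def)
  qed
  have "cmod ((LINT t:G|M. bessel_form f g t)
        - (u *\<^sub>R (LINT t:E|M. bessel_form f g t) + v *\<^sub>R (LINT t:F|M. bessel_form f g t)))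
      \<le> e * norm f * norm g" for f g
  proof -
    note si = set_integrable_bessel_form[unfolded set_integrable_def]
    have "(LINT t:G|M. bessel_form f g t)
        - (u *\<^sub>R (LINT t:E|M. bessel_form f g t) + v *\<^sub>R (LINT t:F|M. bessel_form f g t))
      = (LINT t|M. indicat_real G t *\<^sub>R bessel_form f g t
         - (u *\<^sub>R (indicat_real E t *\<^sub>R bessel_form f g t) + v *\<^sub>R (indicat_real F t *\<^sub>R bessel_form f g t)))"
      unfolding set_lebesgue_integral_def using si[OF E, of f g] si[OF F, of f g] si[OF G, of f g]
      by (simp del: scaleR_scaleR)
    also have "\<dots> = (LINT t|M. w t *\<^sub>R bessel_form f g t)"
      by (intro Bochner_Integration.integral_cong) (auto simp: w_def algebra_simps)
    \<comment> \<open>Splitting off \<open>D\<close> leaves a part annihilated by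
      \<open>discrete\<close>. The other part is at most the integral of the modulus of
      \<open>D\<close>, because \<open>w\<close> is bounded by 1.\<close>
    also have "\<dots> = (LINT t|M. w t *\<^sub>R (bessel_form f g t - D f g t) + w t *\<^sub>R D f g t)"
      by (simp add: scaleR_diff_right)
    also have "\<dots> = (LINT t|M. w t *\<^sub>R (bessel_form f g t - D f g t)) + (LINT t|M. w t *\<^sub>R D f g t)"
      by (intro Bochner_Integration.integral_add w_mult Bochner_Integration.integrable_diff
          integrable_bessel_form D_int)
    also have "\<dots> = (LINT t|M. w t *\<^sub>R D f g t)" by (simp add: discrete)
    finally have eq: "(LINT t:G|M. bessel_form f g t)
        - (u *\<^sub>R (LINT t:E|M. bessel_form f g t) + v *\<^sub>R (LINT t:F|M. bessel_form f g t))
      = (LINT t|M. w t *\<^sub>R D f g t)" .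
    have "ennreal (cmod (LINT t|M. w t *\<^sub>R D f g t)) \<le> (\<integral>\<^sup>+ t. ennreal (norm (w t *\<^sub>R D f g t)) \<partial>M)"
      by (intro integral_norm_bound_ennreal w_mult D_int)
    also have "\<dots> \<le> (\<integral>\<^sup>+ t. ennreal (cmod (D f g t)) \<partial>M)"
      using w_le by (intro nn_integral_mono ennreal_leI) (auto intro!: mult_left_le_one_le)
    also have "\<dots> \<le> ennreal (e * norm f * norm g)" by (rule D_nn)
    finally show ?thesis unfolding eq using e by (subst (asm) ennreal_le_iff) auto
  qed
  with G show ?thesis by (rule that)
qed

section \<open>From forms back to operators\<close>

lemma convex_closure_partial_frame_ops:
  assumes na: "non_atomic M" and sep: "separable_type TYPE('h)"
  shows "convex (closure (partial_frame_ops cinner M phi))"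
proof (rule convex_closureI)
  fix S T :: "'h \<Rightarrow>\<^sub>L 'h" and u v :: real
  assume ST: "S \<in> partial_frame_ops cinner M phi" "T \<in> partial_frame_ops cinner M phi"
    and uv: "0 \<le> u" "0 \<le> v" "u + v = 1"
  obtain E F where E: "E \<in> sets M" "\<And>f g. cinner (S f) g = (LINT t:E|M. bessel_form f g t)"
    and F: "F \<in> sets M" "\<And>f g. cinner (T f) g = (LINT t:F|M. bessel_form f g t)"
    using ST by (auto simp: partial_frame_ops_def is_partial_frame_op_def bessel_form_def)
  obtain D :: "'h set" where D: "countable D" "closure D = UNIV"
    using sep by (auto simp: separable_type_def)
  \<comment> \<open>For a nonempty countable set, \<open>from_nat_into\<close> is a sequence with
    exactly that range, possibly with repetitions.\<close>
  then have "D \<noteq> {}" by auto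
  with D have d: "closure (range (from_nat_into D)) = UNIV" by simp
  show "u *\<^sub>R S + v *\<^sub>R T \<in> closure (partial_frame_ops cinner M phi)"
    unfolding closure_approachable_le
  proof (intro allI impI)
    fix e :: real assume e: "0 < e"
    obtain G where G: "G \<in> sets M"
      "\<And>f g. cmod ((LINT t:G|M. bessel_form f g t)
          - (u *\<^sub>R (LINT t:E|M. bessel_form f g t) + v *\<^sub>R (LINT t:F|M. bessel_form f g t)))
        \<le> e * norm f * norm g"
      using approximate_convexity[OF na d E(1) F(1) uv e] by metis
    obtain R where R: "is_partial_frame_op cinner M phi G R"
      using partial_frame_op_exists[OF G(1)] .
    \<comment> \<open>Testing against all \<open>g\<close> recovers the norm of the image of each
      \<open>f\<close>, so the estimate on forms becomes one in operator norm.\<close>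
    have "norm (R - (u *\<^sub>R S + v *\<^sub>R T)) \<le> e"
    proof (rule norm_blinfun_bound)
      fix f
      show "norm (blinfun_apply (R - (u *\<^sub>R S + v *\<^sub>R T)) f) \<le> e * norm f"
      proof (rule norm_le_if_cinner_le)
        show "cmod (cinner (blinfun_apply (R - (u *\<^sub>R S + v *\<^sub>R T)) f) g) \<le> e * norm f * norm g" for g
          using G(2)[of f g] R E(2) F(2)
          by (simp add: is_partial_frame_op_def bessel_form_def blinfun.diff_left blinfun.add_left
              blinfun.scaleR_left cinner_diff_left cinner_add_left cinner_scaleR_left scaleR_conv_of_real)
      qed (use e in simp)
    qed (use e in simp)
    moreover have "R \<in> partial_frame_ops cinner M phi"
      using R G(1) by (auto simp: partial_frame_ops_def)
    ultimately show "\<exists>y\<in>partial_frame_ops cinner M phi. dist y (u *\<^sub>R S + v *\<^sub>R T) \<le> e"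
      by (auto simp: dist_norm)
  qed
qed

end

theorem theorem3p4:
  fixes M :: "'x measure"
    and cmult :: "complex \<Rightarrow> 'h::banach \<Rightarrow> 'h"
    and cinner :: "'h \<Rightarrow> 'h \<Rightarrow> complex"
    and phi :: "'x \<Rightarrow> 'h"
  assumes "non_atomic M"
    and "complex_hilbert_structure cmult cinner"
    and "separable_type TYPE('h)"
    and "continuous_bessel cinner M phi"
  shows "convex (closure (partial_frame_ops cinner M phi))"
proof -
  interpret bessel_family cmult cinner M phi
    using assms by unfold_locales
  show ?thesis by (rule convex_closure_partial_frame_ops) fact+
qed

end
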